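(* Let $(X_n)_{n\in\mathbb{N}}$ be a stochastic process with modulus of $L_1$-crossings $\psi$. For $M>0$ and $\varepsilon\in(0,1)$ define $$\omega_M(\varepsilon):=(p+2)\cdot\psi\left(M\left(1+\frac{2}{p}\right),p+2\right)\quad\text{for } p:=\left\lceil\frac{8M}{\varepsilon}\right\rceil.$$ If $(X_n)$ has modulus of tightness $h$, then $(X_n)$ converges almost surely, with learnable rate of uniform convergence given by $$\phi(\lambda,\varepsilon):=\frac{2\,\omega_{h(\lambda/2)}(\varepsilon)}{\lambda}.$$
   Context: $\mathbb{N}=\{0,1,2,\ldots\}$, and $[m;n]:=\{m,m+1,\ldots,n\}\subset\mathbb{N}$ (empty if $n<m$). A stochastic process is a sequence $(X_n)_{n\in\mathbb{N}}$ of real-valued random variables on a probability space $(\Omega,\mathcal{F},\mathbb{P})$. Crossings: for a real sequence $(x_n)$ and $\alpha<\beta$, $C_{[\alpha,\beta]}\{x_n\}\in\mathbb{N}\cup\{\infty\}$ is the total number of $[\alpha,\beta]$-crossings, i.e. the supremum of all $k\in\mathbb{N}$ for which there exist indices $i_1<j_1\leq i_2<j_2\leq\cdots\leq i_k<j_k$ such that for each $l=1,\ldots,k$ either $x_{i_l}\leq\alpha$ and $\beta\leq x_{j_l}$, or $x_{j_l}\leq\alpha$ and $\beta\leq x_{i_l}$. For a process, $C_{[\alpha,\beta]}\{X_n\}(\omega):=C_{[\alpha,\beta]}\{X_n(\omega)\}$. Partition: for $M>0$ and $l\geq 1$, $\mathcal{P}(M,l):=\{[-M+\frac{2Mi}{l},-M+\frac{2M(i+1)}{l}]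 : i=0,\ldots,l-1\}$. Modulus of $L_1$-crossings for $(X_n)$: a function $\psi:(0,\infty)\times\mathbb{N}\to\mathbb{R}$ with $\mathbb{E}[C_{[\alpha,\beta]}\{X_n\}]<\psi(M,l)$ for all $M,l$ and all $[\alpha,\beta]\in\mathcal{P}(M,l)$. Modulus of tightness for $(X_n)$: a function $h:(0,1)\to\mathbb{R}$ with $\mathbb{P}(|X_n|\geq h(\lambda))<\lambda$ for all $\lambda\in(0,1)$ and $n\in\mathbb{N}$ (in particular $h(\lambda)>0$). A function $\phi:(0,1)\times(0,1)\to\mathbb{R}$ is a learnable rate of uniform convergence for $(X_n)$ if for all $\lambda,\varepsilon\in(0,1)$ and all natural numbers $a_0<b_0\leq a_1<b_1\leq\cdots$ there exists $n\in\mathbb{N}$ with $n\leq\phi(\lambda,\varepsilon)$ and $\mathbb{P}(\exists i,j\in[a_n;b_n]\ (|X_i-X_j|\geq\varepsilon))<\lambda$. *)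

theory Defs
  imports "HOL-Probability.Probability"
begin

definition has_crossings :: "real \<Rightarrow> real \<Rightarrow> (nat \<Rightarrow> real) \<Rightarrow> nat \<Rightarrow> bool" where
  "has_crossings \<alpha> \<beta> x k \<longleftrightarrow>
     (\<exists>i j :: nat \<Rightarrow> nat.
        (\<forall>l<k. i l < j l) \<and>
        (\<forall>l. Suc l < k \<longrightarrow> j l \<le> i (Suc l)) \<and>
        (\<forall>l<k. (x (i l) \<le> \<alpha> \<and> \<beta> \<le> x (j l)) \<or> (x (j l) \<le> \<alpha> \<and> \<beta> \<le> x (i l))))"

definition crossings :: "real \<Rightarrow> real \<Rightarrow> (nat \<Rightarrow> real) \<Rightarrow> enat" where
  "crossings \<alpha> \<beta> x = (SUP k \<in> {k. has_crossings \<alpha> \<beta> x k}. enat k)"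

definition interval_partition :: "real \<Rightarrow> nat \<Rightarrow> real set set" where
  "interval_partition M l =
     {{- M + 2 * M * real i / real l .. - M + 2 * M * real (i + 1) / real l} | i. i < l}"

(* In the three predicates below, the partial functions psi, h and phi are total functions that are
   constrained only on their stated domains.  For M > 0 the members of the partition are
   nondegenerate, so an interval determines its endpoints.  The expectation of the possibly infinite
   number of crossings is an integral with values in [0, \<infinity>]; since "ennreal" sends
   negative reals to 0, the strict inequality forces psi M l > 0 and a finite expectation. *)

definition modulus_L1_crossings ::
  "'a measure \<Rightarrow> (nat \<Rightarrow> 'a \<Rightarrow> real) \<Rightarrow> (real \<Rightarrow> nat \<Rightarrow> real) \<Rightarrow> bool" where
  "modulus_L1_crossings P X \<psi> \<longleftrightarrow>
     (\<forall>M>0. \<forall>l\<ge>1. \<forall>\<alpha> \<beta>. {\<alpha>..\<beta>} \<in> interval_partition M l \<longrightarrow>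
        (\<integral>\<^sup>+ w. ennreal_of_enat (crossings \<alpha> \<beta> (\<lambda>n. X n w)) \<partial>P) < ennreal (\<psi> M l))"

definition modulus_tightness ::
  "'a measure \<Rightarrow> (nat \<Rightarrow> 'a \<Rightarrow> real) \<Rightarrow> (real \<Rightarrow> real) \<Rightarrow> bool" where
  "modulus_tightness P X h \<longleftrightarrow>
     (\<forall>\<delta>\<in>{0<..<1}. \<forall>n. \<P>(w in P. \<bar>X n w\<bar> \<ge> h \<delta>) < \<delta>)"

definition learnable_uniform_rate ::
  "'a measure \<Rightarrow> (nat \<Rightarrow> 'a \<Rightarrow> real) \<Rightarrow> (real \<Rightarrow> real \<Rightarrow> real) \<Rightarrow> bool" where
  "learnable_uniform_rate P X \<phi> \<longleftrightarrow>
     (\<forall>\<delta>\<in>{0<..<1}. \<forall>\<epsilon>\<in>{0<..<1}. \<forall>a b :: nat \<Rightarrow> nat.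
        (\<forall>n. a n < b n \<and> b n \<le> a (Suc n)) \<longrightarrow>
        (\<exists>n. real n \<le> \<phi> \<delta> \<epsilon> \<and>
             \<P>(w in P. \<exists>i\<in>{a n..b n}. \<exists>j\<in>{a n..b n}. \<bar>X i w - X j w\<bar> \<ge> \<epsilon>) < \<delta>))"

definition crossing_omega :: "(real \<Rightarrow> nat \<Rightarrow> real) \<Rightarrow> real \<Rightarrow> real \<Rightarrow> real" where
  "crossing_omega \<psi> M \<epsilon> =
     (let p = nat \<lceil>8 * M / \<epsilon>\<rceil>
      in real (p + 2) * \<psi> (M * (1 + 2 / real p)) (p + 2))"

end

theory Submission
  imports Defs
begin

text \<open>
  The rate comes from counting crossings block by block. Fix \<open>\<delta>\<close>, \<open>\<epsilon>\<close> and consecutive blocks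
  \<open>[a n; b n]\<close>, put \<open>M = h (\<delta> / 2)\<close>, and cut the line around \<open>[-M, M]\<close> into \<open>p + 2\<close> cells of width
  \<open>2 M / p \<le> \<epsilon> / 4\<close>: \<open>p\<close> cells cover \<open>[-M, M]\<close>, and one more is added on each side. If the process
  oscillates by \<open>\<epsilon>\<close> within a block, some point of the block lies at distance at least \<open>\<epsilon> / 2\<close>, i.e.
  two cell widths, from the value at \<open>a n\<close>. So if that value lies in \<open>(-M, M)\<close>, then one of the cells
  is crossed completely inside the block (\<open>grid_cell_crossed\<close>). By tightness, the value lies outside
  \<open>(-M, M)\<close> with probability less than \<open>\<delta> / 2\<close>.

  If the oscillation had probability at least \<open>\<delta>\<close> in each of the first \<open>K\<close> blocks, then the
  probabilities that a cell is crossed within a block would add up to at least \<open>K \<delta> / 2\<close> over all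
  cells and these blocks. Crossings in distinct blocks are counted separately by the crossing number,
  so for each cell the sum over the blocks is at most the expected number of crossings
  (\<open>sum_block_events_le_expected_crossings\<close>), hence the total is at most \<open>(p + 2) \<psi>\<close>. Taking for \<open>K\<close>
  the number of block indices up to the claimed rate \<open>2 (p + 2) \<psi> / \<delta>\<close> gives a contradiction.

  Almost sure convergence follows from the existence of a learnable rate, whatever its values
  (\<open>AE_convergent_if_learnable_rate\<close>). Otherwise some \<open>\<epsilon>\<close>-oscillation would keep occurring arbitrarily
  late with a probability bounded below, and one could choose successive blocks, each long enough to
  contain it with at least a fixed probability, contradicting the rate on these blocks.
\<close>

section \<open>Crossings of grid cells within disjoint blocks\<close>

definition crosses :: "real \<Rightarrow> real \<Rightarrow> real \<Rightarrow> real \<Rightarrow> bool" where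
  "crosses \<alpha> \<beta> y z \<longleftrightarrow> (y \<le> \<alpha> \<and> \<beta> \<le> z) \<or> (z \<le> \<alpha> \<and> \<beta> \<le> y)"

text \<open>
  A move over two cell widths need not cover the cell it starts in, but it covers the adjacent cell
  in the direction of the move. The extreme cells \<open>0\<close> and \<open>p + 1\<close> serve starting points in the
  cells \<open>1\<close> and \<open>p\<close>.
\<close>

lemma grid_cell_crossed:
  fixes c w y z :: real
  assumes w: "w > 0" and lo: "c + w \<le> y" and hi: "y < c + real (Suc p) * w"
    and far: "2 * w \<le> \<bar>z - y\<bar>"
  shows "\<exists>k<p + 2. crosses (c + real k * w) (c + real (Suc k) * w) y z"
proof -
  \<comment> \<open>The index of the cell that contains \<open>y\<close>.\<close>
  define m where "m = nat \<lfloor>(y - c) / w\<rfloor>"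
  have "(y - c) / w \<ge> 1"
    using w lo by (simp add: field_simps)
  then have m: "real m \<le> (y - c) / w" "(y - c) / w < real m + 1" "1 \<le> m"
    unfolding m_def by linarith+
  have "(y - c) / w < real (Suc p)"
    using w hi by (simp add: field_simps)
  with m have "real m < real (Suc p)"
    by linarith
  then have mp: "m < Suc p"
    by simp
  have m_lo: "c + real m * w \<le> y" and m_hi: "y < c + real (m + 1) * w"
    using m(1,2) w by (simp_all add: field_simps)
  show ?thesis
  proof (cases "y \<le> z")
    case True
    have "crosses (c + real (m + 1) * w) (c + real (Suc (m + 1)) * w) y z"
      using True far m_lo m_hi unfolding crosses_def by (auto simp: algebra_simps)
    then show ?thesis
      using mp by (intro exI[of _ "m + 1"]) auto
  next
    case False
    have "crosses (c + real (m - 1) * w) (c + real (Suc (m - 1)) * w) y z"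
      using False far m_lo m_hi m(3) unfolding crosses_def
      by (auto simp: algebra_simps of_nat_diff)
    then show ?thesis
      using mp by (intro exI[of _ "m - 1"]) auto
  qed
qed

lemma blocks_ordered:
  fixes a b :: "nat \<Rightarrow> nat"
  assumes "\<And>n. a n < b n \<and> b n \<le> a (Suc n)" and "m < n"
  shows "b m \<le> a n"
  using \<open>m < n\<close>
proof (induction n)
  case (Suc n)
  show ?case
  proof (cases "m = n")
    case False
    then have "b m \<le> a n"
      using Suc by simp
    also have "a n \<le> a (Suc n)"
      using assms(1)[of n] by simp
    finally show ?thesis .
  qed (use assms(1) in simp)
qed simp

text \<open>
  The blocks may share endpoints only, so one crossing from each block in \<open>S\<close>, listed in increasing
  order, forms a chain as in the definition of the crossing number.
\<close>

lemma crossings_ge_card_blocks: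
  fixes a b :: "nat \<Rightarrow> nat" and x :: "nat \<Rightarrow> real"
  assumes blocks: "\<And>n. a n < b n \<and> b n \<le> a (Suc n)" and "finite S"
    and cross: "\<And>n. n \<in> S \<Longrightarrow> \<exists>i j. a n \<le> i \<and> i < j \<and> j \<le> b n \<and> crosses \<alpha> \<beta> (x i) (x j)"
  shows "enat (card S) \<le> crossings \<alpha> \<beta> x"
proof -
  obtain i j where ij: "\<And>n. n \<in> S \<Longrightarrow>
      a n \<le> i n \<and> i n < j n \<and> j n \<le> b n \<and> crosses \<alpha> \<beta> (x (i n)) (x (j n))"
    using cross by metis
  define s where "s = (!) (sorted_list_of_set S)"
  have s_in: "s l \<in> S" if "l < card S" for l
    using that \<open>finite S\<close> nth_mem[of l "sorted_list_of_set S"] by (simp add: s_def)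
  have s_less: "s l < s (Suc l)" if "Suc l < card S" for l
    using that strict_sorted_list_of_set[of S] unfolding s_def
    by (simp add: sorted_wrt_nth_less)
  have "has_crossings \<alpha> \<beta> x (card S)"
    unfolding has_crossings_def
  proof (rule exI[of _ "i \<circ> s"], rule exI[of _ "j \<circ> s"], intro conjI allI impI)
    fix l assume l: "l < card S"
    show "(i \<circ> s) l < (j \<circ> s) l"
      using ij[OF s_in[OF l]] by simp
    show "x ((i \<circ> s) l) \<le> \<alpha> \<and> \<beta> \<le> x ((j \<circ> s) l) \<or> x ((j \<circ> s) l) \<le> \<alpha> \<and> \<beta> \<le> x ((i \<circ> s) l)"
      using ij[OF s_in[OF l]] by (simp add: crosses_def)
  next
    fix l assume l: "Suc l < card S"
    have "j (s l) \<le> b (s l)"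
      using ij[OF s_in[of l]] l by simp
    also have "\<dots> \<le> a (s (Suc l))"
      using blocks_ordered[of a b, OF blocks s_less[OF l]] .
    also have "\<dots> \<le> i (s (Suc l))"
      using ij[OF s_in[OF l]] by simp
    finally show "(j \<circ> s) l \<le> (i \<circ> s) (Suc l)"
      by simp
  qed
  then show ?thesis
    unfolding crossings_def by (intro SUP_upper) simp
qed

text \<open>
  The left side is the integral of the number of indices \<open>n < K\<close> whose event occurs. Comparing this
  measurable count with the crossing number needs only monotonicity of the integral; bounding sums of
  expected crossing numbers from below by additivity would require their measurability.
\<close>

lemma sum_block_events_le_expected_crossings:
  fixes a b :: "nat \<Rightarrow> nat" and X :: "nat \<Rightarrow> 'a \<Rightarrow> real"
  assumes blocks: "\<And>n. a n < b n \<and> b n \<le> a (Suc n)"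
    and D: "\<And>n. D n \<in> sets P"
    and cross: "\<And>n w. w \<in> D n \<Longrightarrow>
      \<exists>i j. a n \<le> i \<and> i < j \<and> j \<le> b n \<and> crosses \<alpha> \<beta> (X i w) (X j w)"
  shows "(\<Sum>n<K. emeasure P (D n)) \<le>
    (\<integral>\<^sup>+ w. ennreal_of_enat (crossings \<alpha> \<beta> (\<lambda>n. X n w)) \<partial>P)"
proof -
  have "(\<Sum>n<K. emeasure P (D n)) = (\<integral>\<^sup>+ w. (\<Sum>n<K. indicator (D n) w) \<partial>P)"
    using D by (subst nn_integral_sum) auto
  also have "\<dots> \<le> (\<integral>\<^sup>+ w. ennreal_of_enat (crossings \<alpha> \<beta> (\<lambda>n. X n w)) \<partial>P)"
  proof (rule nn_integral_mono)
    fix w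
    let ?S = "{n. n < K \<and> w \<in> D n}"
    have "(\<Sum>n<K. indicator (D n) w :: ennreal) = (\<Sum>n\<in>?S. 1)"
      by (rule sum.mono_neutral_cong_right) auto
    also have "\<dots> = ennreal_of_enat (enat (card ?S))"
      by simp
    also have "\<dots> \<le> ennreal_of_enat (crossings \<alpha> \<beta> (\<lambda>n. X n w))"
      by (subst ennreal_of_enat_le_iff, rule crossings_ge_card_blocks[of a b, OF blocks])
         (use cross in auto)
    finally show "(\<Sum>n<K. indicator (D n) w) \<le> ennreal_of_enat (crossings \<alpha> \<beta> (\<lambda>n. X n w))" .
  qed
  finally show ?thesis .
qed

section \<open>The learnable rate\<close>

definition oscillation_event ::
  "'a measure \<Rightarrow> (nat \<Rightarrow> 'a \<Rightarrow> real) \<Rightarrow> real \<Rightarrow> nat \<Rightarrow> nat \<Rightarrow> 'a set" where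
  "oscillation_event P X \<epsilon> m n =
     {w \<in> space P. \<exists>i\<in>{m..n}. \<exists>j\<in>{m..n}. \<bar>X i w - X j w\<bar> \<ge> \<epsilon>}"

lemma sets_oscillation_event:
  assumes [measurable]: "\<And>n. X n \<in> borel_measurable P"
  shows "oscillation_event P X \<epsilon> m n \<in> sets P"
  unfolding oscillation_event_def by measurable

lemma learnable_rate_from_crossings:
  fixes X :: "nat \<Rightarrow> 'a \<Rightarrow> real"
  assumes P: "prob_space P" and X [measurable]: "\<And>n. X n \<in> borel_measurable P"
    and cr: "modulus_L1_crossings P X \<psi>" and ti: "modulus_tightness P X h"
  shows "learnable_uniform_rate P X (\<lambda>\<delta> \<epsilon>. 2 * crossing_omega \<psi> (h (\<delta> / 2)) \<epsilon> / \<delta>)"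
  unfolding learnable_uniform_rate_def
proof (intro ballI allI impI)
  interpret prob_space P by fact
  fix \<delta> \<epsilon> :: real and a b :: "nat \<Rightarrow> nat"
  assume \<delta>: "\<delta> \<in> {0<..<1}" and \<epsilon>: "\<epsilon> \<in> {0<..<1}"
    and "\<forall>n. a n < b n \<and> b n \<le> a (Suc n)"
  then have blocks: "a n < b n \<and> b n \<le> a (Suc n)" for n
    by blast
  define M where "M = h (\<delta> / 2)"
  have tight: "\<P>(w in P. \<bar>X n w\<bar> \<ge> M) < \<delta> / 2" for n
    using ti[unfolded modulus_tightness_def, rule_format, of "\<delta> / 2" n] \<delta> by (simp add: M_def)
  \<comment> \<open>For nonpositive \<open>M\<close> the event in the tightness bound would be the whole space.\<close>
  have M: "M > 0"
  proof (rule ccontr)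
    assume "\<not> M > 0"
    then have "{w \<in> space P. \<bar>X 0 w\<bar> \<ge> M} = space P"
      by auto
    with tight[of 0] \<delta> show False
      by (simp add: prob_space)
  qed
  \<comment> \<open>\<open>w0\<close> is the cell width; the grid starts at \<open>c\<close>, one cell below \<open>-M\<close>.\<close>
  define p where "p = nat \<lceil>8 * M / \<epsilon>\<rceil>"
  define w0 where "w0 = 2 * M / real p"
  define c where "c = - M - w0"
  have "8 * M / \<epsilon> > 0"
    using M \<epsilon> by simp
  then have p: "p > 0" "8 * M / \<epsilon> \<le> real p"
    unfolding p_def by linarith+
  have w0: "w0 > 0" "2 * w0 \<le> \<epsilon> / 2"
    using M p \<epsilon> by (simp_all add: w0_def field_simps)
  have pw0: "real p * w0 = 2 * M"
    using p by (simp add: w0_def)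
  define \<alpha> where "\<alpha> k = c + real k * w0" for k :: nat
  define \<Psi> where "\<Psi> = \<psi> (M * (1 + 2 / real p)) (p + 2)"
  let ?\<phi> = "2 * crossing_omega \<psi> M \<epsilon> / \<delta>"
  have \<phi>: "?\<phi> = 2 * (real (p + 2) * \<Psi>) / \<delta>"
    by (simp add: crossing_omega_def \<Psi>_def p_def Let_def)
  have expected: "(\<integral>\<^sup>+ w. ennreal_of_enat (crossings (\<alpha> k) (\<alpha> (Suc k)) (\<lambda>n. X n w)) \<partial>P)
      < ennreal \<Psi>" if k: "k < p + 2" for k
  proof -
    have pt: "- (M * (1 + 2 / real p)) + 2 * (M * (1 + 2 / real p)) * real i / real (p + 2) = \<alpha> i"
      for i
      using p by (simp add: \<alpha>_def c_def w0_def divide_simps) (simp add: algebra_simps)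
    have "{\<alpha> k..\<alpha> (Suc k)} \<in> interval_partition (M * (1 + 2 / real p)) (p + 2)"
      unfolding interval_partition_def mem_Collect_eq pt using k by auto
    moreover have "M * (1 + 2 / real p) > 0"
      using M p by (simp add: add_pos_nonneg)
    ultimately show ?thesis
      using cr unfolding modulus_L1_crossings_def \<Psi>_def by auto
  qed
  have "ennreal \<Psi> > 0"
    using expected[of 0] by (rule order.strict_trans1[OF zero_le]) simp
  then have \<Psi>: "\<Psi> > 0"
    by simp
  \<comment> \<open>Within block \<open>n\<close> the process gets from its value at \<open>a n\<close> across cell \<open>k\<close>.\<close>
  define D where "D k n = {w \<in> space P. \<exists>i\<in>{a n..b n}. crosses (\<alpha> k) (\<alpha> (Suc k)) (X (a n) w) (X i w)}"
    for k n
  have D_sets [measurable]: "D k n \<in> sets P" for k n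
    unfolding D_def crosses_def by measurable
  have D_sum: "(\<Sum>n<K. prob (D k n)) \<le> \<Psi>" if k: "k < p + 2" for k K
  proof -
    have "ennreal (\<Sum>n<K. prob (D k n)) = (\<Sum>n<K. emeasure P (D k n))"
      by (simp add: emeasure_eq_measure sum_ennreal)
    also have "\<dots> \<le> (\<integral>\<^sup>+ w. ennreal_of_enat (crossings (\<alpha> k) (\<alpha> (Suc k)) (\<lambda>n. X n w)) \<partial>P)"
    proof (rule sum_block_events_le_expected_crossings[of a b, OF blocks D_sets])
      fix n w assume "w \<in> D k n"
      then obtain i where i: "i \<in> {a n..b n}" "crosses (\<alpha> k) (\<alpha> (Suc k)) (X (a n) w) (X i w)"
        unfolding D_def by auto
      have "\<alpha> k < \<alpha> (Suc k)"
        using w0 by (simp add: \<alpha>_def)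
      with i(2) have "i \<noteq> a n"
        by (auto simp: crosses_def)
      with i show "\<exists>i j. a n \<le> i \<and> i < j \<and> j \<le> b n \<and> crosses (\<alpha> k) (\<alpha> (Suc k)) (X i w) (X j w)"
        by (intro exI[of _ "a n"] exI[of _ i]) auto
    qed
    also have "\<dots> \<le> ennreal \<Psi>"
      using expected[OF k] by simp
    finally show ?thesis
      using \<Psi> by simp
  qed
  have osc_subset: "oscillation_event P X \<epsilon> (a n) (b n) \<subseteq>
      {w \<in> space P. \<bar>X (a n) w\<bar> \<ge> M} \<union> (\<Union>k<p + 2. D k n)" for n
  proof
    fix w assume "w \<in> oscillation_event P X \<epsilon> (a n) (b n)"
    then obtain i j where w: "w \<in> space P" and i: "i \<in> {a n..b n}" and j: "j \<in> {a n..b n}"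
      and ij: "\<epsilon> \<le> \<bar>X i w - X j w\<bar>"
      unfolding oscillation_event_def by blast
    have "\<epsilon> / 2 \<le> \<bar>X i w - X (a n) w\<bar> \<or> \<epsilon> / 2 \<le> \<bar>X j w - X (a n) w\<bar>"
      using ij by linarith
    then obtain m where m: "m \<in> {a n..b n}" "\<epsilon> / 2 \<le> \<bar>X m w - X (a n) w\<bar>"
      using i j by blast
    show "w \<in> {w \<in> space P. \<bar>X (a n) w\<bar> \<ge> M} \<union> (\<Union>k<p + 2. D k n)"
    proof (cases "\<bar>X (a n) w\<bar> \<ge> M")
      case False
      have "c + real (Suc p) * w0 = M"
        using pw0 by (simp add: c_def algebra_simps)
      then obtain k where "k < p + 2" "crosses (\<alpha> k) (\<alpha> (Suc k)) (X (a n) w) (X m w)"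
        using grid_cell_crossed[of w0 c "X (a n) w" p "X m w"] w0 m(2) False
        unfolding \<alpha>_def c_def by force
      then show ?thesis
        using w m(1) by (auto simp: D_def)
    qed (use w in simp)
  qed
  have osc_prob: "prob (oscillation_event P X \<epsilon> (a n) (b n)) < \<delta> / 2 + (\<Sum>k<p + 2. prob (D k n))"
    for n
  proof -
    have "prob (oscillation_event P X \<epsilon> (a n) (b n)) \<le>
        prob ({w \<in> space P. \<bar>X (a n) w\<bar> \<ge> M} \<union> (\<Union>k<p + 2. D k n))"
      by (rule finite_measure_mono[OF osc_subset]) measurable
    also have "\<dots> \<le> \<P>(w in P. \<bar>X (a n) w\<bar> \<ge> M) + prob (\<Union>k<p + 2. D k n)"
      by (rule measure_Un_le) measurable
    also have "prob (\<Union>k<p + 2. D k n) \<le> (\<Sum>k<p + 2. prob (D k n))"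
      by (rule measure_UNION_le) auto
    finally show ?thesis
      using tight[of "a n"] by linarith
  qed
  have "\<exists>n. real n \<le> ?\<phi> \<and> prob (oscillation_event P X \<epsilon> (a n) (b n)) < \<delta>"
  proof (rule ccontr)
    assume "\<not> ?thesis"
    then have big: "\<delta> \<le> prob (oscillation_event P X \<epsilon> (a n) (b n))" if "real n \<le> ?\<phi>" for n
      using that by (meson not_less)
    \<comment> \<open>The number of block indices \<open>n\<close> with \<open>real n \<le> ?\<phi>\<close>; counting \<open>n = 0\<close> makes it exceed \<open>?\<phi>\<close>.\<close>
    define K where "K = Suc (nat \<lfloor>?\<phi>\<rfloor>)"
    have \<phi>_nonneg: "?\<phi> \<ge> 0"
      using \<Psi> \<delta> unfolding \<phi> by simp
    have K: "?\<phi> < real K"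
      unfolding K_def using \<phi>_nonneg by linarith
    have below_K: "real n \<le> ?\<phi>" if "n < K" for n
      using that \<phi>_nonneg unfolding K_def by linarith
    have "real K * (\<delta> / 2) = (\<Sum>n<K. \<delta> / 2)"
      by simp
    also have "\<dots> \<le> (\<Sum>n<K. \<Sum>k<p + 2. prob (D k n))"
      using osc_prob big below_K by (intro sum_mono) (smt (verit) field_sum_of_halves lessThan_iff)
    also have "\<dots> = (\<Sum>k<p + 2. \<Sum>n<K. prob (D k n))"
      by (rule sum.swap)
    also have "\<dots> \<le> (\<Sum>k<p + 2. \<Psi>)"
      by (intro sum_mono D_sum) simp
    also have "\<dots> = ?\<phi> * (\<delta> / 2)"
      using \<delta> unfolding \<phi> by simp
    finally show False
      using K \<delta> by (simp add: pos_divide_less_eq)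
  qed
  then show "\<exists>n. real n \<le> 2 * crossing_omega \<psi> (h (\<delta> / 2)) \<epsilon> / \<delta> \<and>
      \<P>(w in P. \<exists>i\<in>{a n..b n}. \<exists>j\<in>{a n..b n}. \<bar>X i w - X j w\<bar> \<ge> \<epsilon>) < \<delta>"
    unfolding oscillation_event_def M_def .
qed

section \<open>Almost sure convergence from a learnable rate\<close>

text \<open>
  If the claim fails, every starting point \<open>m\<close> has a block \<open>[m; g m]\<close> on which the oscillation has
  probability at least \<open>\<delta>\<close>; iterating \<open>g\<close> chains such blocks into a sequence that refutes the rate.
\<close>

lemma learnable_rate_eventually_small:
  assumes rate: "learnable_uniform_rate P X \<phi>" and \<delta>: "\<delta> \<in> {0<..<1}" and \<epsilon>: "\<epsilon> \<in> {0<..<1}"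
  shows "\<exists>m. \<forall>n>m. measure P (oscillation_event P X \<epsilon> m n) < \<delta>"
proof (rule ccontr)
  assume "\<not> ?thesis"
  then obtain g where g: "\<And>m. g m > m \<and> measure P (oscillation_event P X \<epsilon> m (g m)) \<ge> \<delta>"
    by (metis not_less)
  define a where "a n = (g ^^ n) 0" for n
  have "\<forall>n. a n < g (a n) \<and> g (a n) \<le> a (Suc n)"
    using g by (simp add: a_def)
  then have "\<exists>n. measure P (oscillation_event P X \<epsilon> (a n) (g (a n))) < \<delta>"
    using rate[unfolded learnable_uniform_rate_def, rule_format, of \<delta> \<epsilon> a "\<lambda>n. g (a n)"] \<delta> \<epsilon>
    unfolding oscillation_event_def by blast
  with g show False
    by (meson not_less)
qed

text \<open>
  A point whose path oscillates by at least \<open>\<epsilon>\<close> beyond every index lies in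
  \<open>\<Inter>m. \<Union>n. oscillation_event P X \<epsilon> m n\<close>. The events increase with \<open>n\<close>, so by continuity from below the uniform bound over all \<open>n > m\<close> passes to their
  union, and this set is null. Letting \<open>\<epsilon>\<close> run through a sequence tending to \<open>0\<close> shows that almost
  every path is Cauchy.
\<close>

lemma AE_convergent_if_learnable_rate:
  fixes X :: "nat \<Rightarrow> 'a \<Rightarrow> real"
  assumes P: "prob_space P" and X: "\<And>n. X n \<in> borel_measurable P"
    and rate: "learnable_uniform_rate P X \<phi>"
  shows "AE w in P. convergent (\<lambda>n. X n w)"
proof -
  interpret prob_space P by fact
  note [measurable] = sets_oscillation_event[OF X]
  have ae: "AE w in P. \<exists>m. \<forall>n>m. w \<notin> oscillation_event P X \<epsilon> m n" if \<epsilon>: "\<epsilon> \<in> {0<..<1}" for \<epsilon>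
  proof -
    let ?N = "\<Inter>m. \<Union>n. oscillation_event P X \<epsilon> m n"
    have "prob ?N \<le> 0 + \<delta>" if "0 < \<delta>" for \<delta>
    proof (cases "\<delta> < 1")
      case True
      then have "\<delta> \<in> {0<..<1}"
        using that by simp
      then obtain m where m: "\<And>n. n > m \<Longrightarrow> prob (oscillation_event P X \<epsilon> m n) < \<delta>"
        using learnable_rate_eventually_small[OF rate _ \<epsilon>] by blast
      have "incseq (oscillation_event P X \<epsilon> m)"
        by (rule incseq_SucI) (force simp: oscillation_event_def)
      then have "(\<lambda>n. prob (oscillation_event P X \<epsilon> m n)) \<longlonglongrightarrow> prob (\<Union>n. oscillation_event P X \<epsilon> m n)"
        by (intro finite_Lim_measure_incseq) auto
      then have "prob (\<Union>n. oscillation_event P X \<epsilon> m n) \<le> \<delta>"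
        by (rule LIMSEQ_le_const2) (use m in \<open>auto intro!: exI[of _ "Suc m"] less_imp_le\<close>)
      moreover have "prob ?N \<le> prob (\<Union>n. oscillation_event P X \<epsilon> m n)"
        by (intro finite_measure_mono) auto
      ultimately show ?thesis
        by simp
    qed (use prob_le_1[of ?N] in linarith)
    then have "prob ?N \<le> 0"
      by (rule field_le_epsilon)
    then have "emeasure P ?N = 0"
      by (simp add: emeasure_eq_measure measure_le_0_iff)
    moreover have "?N \<in> sets P"
      by measurable
    ultimately have "AE w in P. w \<notin> ?N"
      by (intro AE_not_in) auto
    then show ?thesis
      by eventually_elim auto
  qed
  \<comment> \<open>The shift by \<open>2\<close> keeps the tolerance strictly below \<open>1\<close>, where the rate applies.\<close>
  have "AE w in P. \<forall>k::nat. \<exists>m. \<forall>n>m. w \<notin> oscillation_event P X (1 / real (k + 2)) m n"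
    by (subst AE_all_countable) (intro allI ae, auto)
  with AE_space show ?thesis
  proof eventually_elim
    case (elim w)
    have "Cauchy (\<lambda>n. X n w)"
      unfolding Cauchy_def
    proof (intro allI impI)
      fix e :: real assume "e > 0"
      then obtain k :: nat where k: "1 / real (Suc k) < e"
        using nat_approx_posE by metis
      obtain m where m: "\<And>n. n > m \<Longrightarrow> w \<notin> oscillation_event P X (1 / real (k + 2)) m n"
        using elim(2) by blast
      have "dist (X i w) (X j w) < e" if "i \<ge> m" "j \<ge> m" for i j
      proof -
        have "\<bar>X i w - X j w\<bar> < 1 / real (k + 2)"
          using m[of "Suc (max i j)"] that elim(1)
          by (force simp: oscillation_event_def not_le)
        also have "\<dots> \<le> 1 / real (Suc k)"
          by (simp add: field_simps)
        finally show ?thesis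
          using k by (simp add: dist_real_def)
      qed
      then show "\<exists>M. \<forall>i\<ge>M. \<forall>j\<ge>M. dist (X i w) (X j w) < e"
        by blast
    qed
    then show ?case
      by (simp add: Cauchy_convergent_iff)
  qed
qed

theorem theorem6p3:
  fixes P :: "'a measure"
    and X :: "nat \<Rightarrow> 'a \<Rightarrow> real"
    and \<psi> :: "real \<Rightarrow> nat \<Rightarrow> real"
    and h :: "real \<Rightarrow> real"
  assumes "prob_space P"
    and "\<And>n. X n \<in> borel_measurable P"
    and "modulus_L1_crossings P X \<psi>"
    and "modulus_tightness P X h"
  shows "(AE w in P. convergent (\<lambda>n. X n w)) \<and>
    learnable_uniform_rate P X (\<lambda>\<delta> \<epsilon>. 2 * crossing_omega \<psi> (h (\<delta> / 2)) \<epsilon> / \<delta>)"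
proof
  show rate: "learnable_uniform_rate P X (\<lambda>\<delta> \<epsilon>. 2 * crossing_omega \<psi> (h (\<delta> / 2)) \<epsilon> / \<delta>)"
    by (rule learnable_rate_from_crossings[OF assms])
  show "AE w in P. convergent (\<lambda>n. X n w)"
    by (rule AE_convergent_if_learnable_rate[OF assms(1,2) rate])
qed

end
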